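(* Let $(p_n(x))_{n\ge 0}$ be a family of monic polynomials over $\mathbb{C}$ with $\deg p_n=n$ and $p_n(0)=0$ for all $n\ge 1$. Put $Q_y(x)=\sum_{m\ge 0}\frac{p_m(x)y^m}{m!}\in\mathbb{C}[x][[y]]$, $Q_y'(x)=\partial_xQ_y(x)$, $\dot Q_y(x)=\partial_yQ_y(x)$. Then for every integer $n\ge 1$ $$\frac{x}{n}\,\frac{p_n'(x)}{p_n(x)}=\left(1+\frac{Q_y(x)}{\dot Q_y(x)}\,(\partial_y-n\mathrm{L})\right)^{-1}\cdot\ \frac{x}{y}\,\frac{Q_y'(x)}{\dot Q_y(x)}\ \bigg|_{y=0},$$ where $(1+W)^{-1}$, with $W=\frac{Q_y(x)}{\dot Q_y(x)}(\partial_y-n\mathrm{L})$, is interpreted as $1-W+W^2-\cdots$. That is, the series $$\sum_{k\ge 0}(-1)^k\left[W^k\cdot \frac{x}{y}\frac{Q_y'(x)}{\dot Q_y(x)}\right]_{y=0}$$ of Laurent polynomials in $x$ converges in $\mathbb{C}((x^{-1}))$, and its sum is the expansion at $x=\infty$ of the rational function $\frac{x}{n}\frac{p_n'(x)}{p_n(x)}$.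
   Context: $\mathrm{L}$ is the operator on formal power series in $y$ given by $\mathrm{L}\cdot g(y)=\frac{g(y)-g(0)}{y}$. It and $\partial_y$ act on $\mathbb{C}[x,x^{-1}][[y]]$, with $x$ treated as a constant. Since $p_0=1$ and $p_1(x)=x$, the series $\dot Q_y(x)$ has constant term $x$ in $y$ and $Q_y'(x)$ is divisible by $y$. Hence $\frac{Q_y(x)}{\dot Q_y(x)}$ and $\frac{x}{y}\frac{Q_y'(x)}{\dot Q_y(x)}$ are elements of $\mathbb{C}[x,x^{-1}][[y]]$. In $W$, the factor $\frac{Q_y(x)}{\dot Q_y(x)}$ acts by multiplication after $\partial_y-n\mathrm{L}$ has been applied. Here $\mathbb{C}((x^{-1}))$ is the field of formal Laurent series in $x^{-1}$ with its usual $x^{-1}$-adic topology (a series converges iff the degrees in $x$ of its terms tend to $-\infty$). *)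

theory Defs
  imports "HOL-Computational_Algebra.Computational_Algebra"
begin

text \<open>
  The type \<open>complex fls\<close> serves as \<open>\<complex>((x\<^sup>-\<^sup>1))\<close>: its formal variable \<open>fls_X\<close> stands for \<open>x\<^sup>-\<^sup>1\<close>,
  so \<open>x\<close> itself is \<open>fls_X_inv\<close>, and the library metric on \<open>fls\<close> induces the
  \<open>x\<^sup>-\<^sup>1\<close>-adic topology.  Series in \<open>y\<close> over \<open>\<complex>[x, x\<^sup>-\<^sup>1] \<subseteq> \<complex>((x\<^sup>-\<^sup>1))\<close> are elements of
  \<open>complex fls fps\<close>, with \<open>y\<close> being \<open>fps_X\<close>.
\<close>

abbreviation x_inf :: "complex fls" where
  "x_inf \<equiv> fls_X_inv"

text \<open>The embedding \<open>\<complex>[x] \<rightarrow> \<complex>((x\<^sup>-\<^sup>1))\<close>, i.e. expansion at \<open>x = \<infinity>\<close>.\<close>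

definition poly_at_inf :: "complex poly \<Rightarrow> complex fls" where
  "poly_at_inf q = poly (map_poly fls_const q) x_inf"

definition is_laurent_poly :: "complex fls \<Rightarrow> bool" where
  "is_laurent_poly f \<longleftrightarrow> finite {k. fls_nth f k \<noteq> 0}"

definition series_at_inf :: "complex poly fps \<Rightarrow> complex fls fps" where
  "series_at_inf G = Abs_fps (\<lambda>m. poly_at_inf (fps_nth G m))"

definition Qser :: "(nat \<Rightarrow> complex poly) \<Rightarrow> complex poly fps" where
  "Qser p = Abs_fps (\<lambda>m. smult (1 / fact m) (p m))"

definition dx :: "complex poly fps \<Rightarrow> complex poly fps" where
  "dx G = Abs_fps (\<lambda>m. pderiv (fps_nth G m))"

definition Lop :: "complex fls fps \<Rightarrow> complex fls fps" where
  "Lop g = (g - fps_const (fps_nth g 0)) / fps_X"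

definition Wop :: "(nat \<Rightarrow> complex poly) \<Rightarrow> nat \<Rightarrow> complex fls fps \<Rightarrow> complex fls fps" where
  "Wop p n g = series_at_inf (Qser p) / series_at_inf (fps_deriv (Qser p))
                 * (fps_deriv g - of_nat n * Lop g)"

definition Fser :: "(nat \<Rightarrow> complex poly) \<Rightarrow> complex fls fps" where
  "Fser p = (fps_const x_inf * series_at_inf (dx (Qser p)) / fps_X)
              / series_at_inf (fps_deriv (Qser p))"

end

theory Submission
  imports Defs
begin

text \<open>
  Write \<open>Q\<close> for the given series, \<open>Q'\<close> and \<open>D\<close> for its derivatives in \<open>x\<close> and \<open>y\<close>, \<open>F = x Q' / (y D)\<close>,
  and let \<open>h\<^sub>0\<close> be the coefficient of \<open>y\<^sup>0\<close> in \<open>h\<close>.  If \<open>g\<close> solves \<open>(1 + W) g = F\<close>, then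
  multiplication by \<open>y D\<close> gives
  \<open>(y \<partial>\<^sub>y - n) (Q g) + n Q g\<^sub>0 = x Q'\<close>, and since \<open>y \<partial>\<^sub>y - n\<close> annihilates \<open>y\<^sup>n\<close>, the coefficients
  of \<open>y\<^sup>n\<close> give \<open>n p\<^sub>n g\<^sub>0 = x p\<^sub>n'\<close>, which is the claimed value.  The same computation
  works without a solution \<open>g\<close>.  Let \<open>b\<^sub>k\<close> be the coefficient of \<open>y\<^sup>n\<close> in
  \<open>y D W\<^sup>k F\<close>, divided by \<open>n p\<^sub>n / n!\<close>; then the constant term of \<open>W\<^sup>k F\<close> is
  \<open>b\<^sub>k + b\<^sub>k\<^sub>+\<^sub>1\<close> (lemma \<open>Wop_telescope\<close>), so the alternating series telescopes, and its sum is
  \<open>b\<^sub>0 = (x/n) p\<^sub>n'/p\<^sub>n\<close> as soon as \<open>b\<^sub>k \<rightarrow> 0\<close> (lemma \<open>Wop_sums\<close>).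

  For the convergence, put \<open>y = t/x\<close>.  As the \<open>p\<^sub>m\<close> are monic of degree \<open>m\<close>, \<open>Q\<close> and \<open>D/x\<close> both become
  \<open>e\<^sup>t + O(1/x)\<close>, so \<open>W\<close> is \<open>W\<^sub>0 = \<partial>\<^sub>t - n L\<^sub>t\<close> followed by multiplication by
  \<open>1 + O(1/x)\<close>.  Since \<open>W\<^sub>0 t\<^sup>j = (j - n) t\<^sup>j\<^sup>-\<^sup>1\<close> vanishes at \<open>j = n\<close>, the coefficients of
  \<open>t\<^sup>0, \<dots>, t\<^sup>n\<^sup>-\<^sup>1\<close> of \<open>W h\<close> depend only on those of \<open>h\<close>, and \<open>W\<^sub>0\<close> is nilpotent on them.
  To see the contraction in every single step, give \<open>x\<^sup>-\<^sup>a t\<^sup>j\<close> the weight \<open>n a - j\<close>: then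
  \<open>W\<^sub>0\<close> gains 1 by lowering \<open>j\<close>, whereas a factor \<open>1/x\<close> gains \<open>n\<close> and the accompanying power of \<open>t\<close>
  loses less than \<open>n\<close>.  Back in \<open>y\<close>, this is the multiplicative weight \<open>n i + (n - 1) j\<close> of \<open>x\<^sup>-\<^sup>i y\<^sup>j\<close>,
  and \<open>W\<close> raises it by at least 1 (lemma \<open>weight_Wop\<close>).
\<close>

unbundle Formal_Power_Series.fps_syntax and Formal_Laurent_Series.fps_syntax

section \<open>Valuation bounds for Laurent series\<close>

text \<open>
  The lower bound \<open>c \<le> a * ord f\<close>.  It is scaled by \<open>a\<close> because the weights used below give
  \<open>x\<^sup>-\<^sup>1\<close> the value \<open>n\<close>; quantifying over the support includes \<open>f = 0\<close> without an infinite order.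
\<close>

definition ord_ge :: "int \<Rightarrow> int \<Rightarrow> 'a::zero fls \<Rightarrow> bool" where
  "ord_ge a c f \<longleftrightarrow> (\<forall>i. f $$ i \<noteq> 0 \<longrightarrow> c \<le> a * i)"

lemma ord_geD: "ord_ge a c f \<Longrightarrow> f $$ i \<noteq> 0 \<Longrightarrow> c \<le> a * i"
  by (simp add: ord_ge_def)

lemma ord_ge_zero [simp]: "ord_ge a c 0"
  by (simp add: ord_ge_def)

lemma ord_ge_mono: "ord_ge a c f \<Longrightarrow> d \<le> c \<Longrightarrow> ord_ge a d f"
  by (auto simp: ord_ge_def)

lemma ord_ge_scale: "ord_ge 1 c f \<Longrightarrow> 0 \<le> a \<Longrightarrow> ord_ge a (a * c) f"
  by (auto simp: ord_ge_def intro!: mult_left_mono)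

lemma ord_ge_add:
  fixes f g :: "'a::group_add fls"
  shows "ord_ge a c f \<Longrightarrow> ord_ge a c g \<Longrightarrow> ord_ge a c (f + g)"
  unfolding ord_ge_def
proof (intro allI impI)
  fix i assume *: "\<forall>i. f $$ i \<noteq> 0 \<longrightarrow> c \<le> a * i" "\<forall>i. g $$ i \<noteq> 0 \<longrightarrow> c \<le> a * i" "(f + g) $$ i \<noteq> 0"
  then have "f $$ i \<noteq> 0 \<or> g $$ i \<noteq> 0"
    by auto
  with * show "c \<le> a * i"
    by blast
qed

lemma ord_ge_diff:
  fixes f g :: "'a::group_add fls"
  shows "ord_ge a c f \<Longrightarrow> ord_ge a c g \<Longrightarrow> ord_ge a c (f - g)"
  unfolding ord_ge_def
proof (intro allI impI)
  fix i assume *: "\<forall>i. f $$ i \<noteq> 0 \<longrightarrow> c \<le> a * i" "\<forall>i. g $$ i \<noteq> 0 \<longrightarrow> c \<le> a * i" "(f - g) $$ i \<noteq> 0"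
  then have "f $$ i \<noteq> 0 \<or> g $$ i \<noteq> 0"
    by auto
  with * show "c \<le> a * i"
    by blast
qed

lemma ord_ge_sum:
  fixes f :: "'b \<Rightarrow> 'a::ab_group_add fls"
  shows "(\<And>x. x \<in> A \<Longrightarrow> ord_ge a c (f x)) \<Longrightarrow> ord_ge a c (sum f A)"
  by (induction A rule: infinite_finite_induct) (auto intro: ord_ge_add)

lemma fls_times_nth_nonzeroE:
  fixes f g :: "'a::comm_ring_1 fls"
  assumes "(f * g) $$ i \<noteq> 0"
  obtains l where "f $$ l \<noteq> 0" "g $$ (i - l) \<noteq> 0"
proof -
  from assms have "(\<Sum>l=fls_subdegree f..i - fls_subdegree g. f $$ l * g $$ (i - l)) \<noteq> 0"
    by (simp add: fls_times_nth(2))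
  then obtain l where "f $$ l * g $$ (i - l) \<noteq> 0"
    by (meson sum.neutral)
  then have "f $$ l \<noteq> 0" "g $$ (i - l) \<noteq> 0"
    by auto
  then show thesis
    by (rule that)
qed

lemma ord_ge_mult:
  fixes f g :: "'a::comm_ring_1 fls"
  assumes "ord_ge a c f" "ord_ge a d g"
  shows "ord_ge a (c + d) (f * g)"
  unfolding ord_ge_def
proof (intro allI impI)
  fix i assume "(f * g) $$ i \<noteq> 0"
  then obtain l where "f $$ l \<noteq> 0" "g $$ (i - l) \<noteq> 0"
    by (rule fls_times_nth_nonzeroE)
  then have "c + d \<le> a * l + a * (i - l)"
    by (intro add_mono ord_geD[OF assms(1)] ord_geD[OF assms(2)])
  then show "c + d \<le> a * i"
    by (simp add: algebra_simps)
qed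

lemma ord_ge_fls_X: "ord_ge a a (fls_X :: 'a::zero_neq_one fls)"
  by (simp add: ord_ge_def)

lemma ord_ge_of_nat: "ord_ge a 0 (of_nat m :: 'a::comm_ring_1 fls)"
  by (simp add: ord_ge_def fls_of_nat_nth)

lemma ord_ge_exists:
  fixes f :: "'a::zero fls"
  assumes "0 \<le> a"
  shows "\<exists>c. ord_ge a c f"
proof
  show "ord_ge a (a * fls_subdegree f) f"
    using assms by (auto simp: ord_ge_def intro!: mult_left_mono fls_subdegree_leI)
qed

lemma fls_tendstoI:
  fixes S :: "nat \<Rightarrow> 'a::group_add fls"
  assumes "\<And>N. \<forall>\<^sub>F k in sequentially. ord_ge 1 N (S k - T)"
  shows "S \<longlonglongrightarrow> T"
proof (rule tendstoI)
  fix e :: real assume "0 < e"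
  then obtain N where N: "inverse (2 ^ N) < e"
    using real_arch_pow_inv[of e "1/2"] by (auto simp: power_one_over inverse_eq_divide)
  show "\<forall>\<^sub>F k in sequentially. dist (S k) T < e"
    using assms[of "int N"]
  proof eventually_elim
    case (elim k)
    show ?case
    proof (cases "S k = T")
      case False
      then have "int N \<le> fls_subdegree (S k - T)"
        using ord_geD[OF elim nth_fls_subdegree_nonzero] by simp
      moreover from this have "inverse (2 ^ nat (fls_subdegree (S k - T))) \<le> (inverse (2 ^ N) :: real)"
        by (intro le_imp_inverse_le power_increasing) auto
      ultimately show ?thesis
        using order.strict_trans1[OF _ N] False by (simp add: dist_fls_def)
    qed (use \<open>0 < e\<close> in simp)
  qed
qed

section \<open>Laurent polynomials\<close>

lemma is_laurent_poly_zero [simp]: "is_laurent_poly 0"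
  by (simp add: is_laurent_poly_def)

lemma is_laurent_poly_add:
  assumes "is_laurent_poly f" "is_laurent_poly g" shows "is_laurent_poly (f + g)"
proof -
  have "{k. (f + g) $$ k \<noteq> 0} \<subseteq> {k. f $$ k \<noteq> 0} \<union> {k. g $$ k \<noteq> 0}"
    by auto
  then show ?thesis
    using assms unfolding is_laurent_poly_def by (meson finite_Un finite_subset)
qed

lemma is_laurent_poly_diff:
  assumes "is_laurent_poly f" "is_laurent_poly g" shows "is_laurent_poly (f - g)"
proof -
  have "{k. (f - g) $$ k \<noteq> 0} \<subseteq> {k. f $$ k \<noteq> 0} \<union> {k. g $$ k \<noteq> 0}"
    by auto
  then show ?thesis
    using assms unfolding is_laurent_poly_def by (meson finite_Un finite_subset)
qed

lemma is_laurent_poly_sum: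
  "(\<And>x. x \<in> A \<Longrightarrow> is_laurent_poly (f x)) \<Longrightarrow> is_laurent_poly (sum f A)"
  by (induction A rule: infinite_finite_induct) (auto intro: is_laurent_poly_add)

lemma is_laurent_poly_mult:
  assumes "is_laurent_poly f" "is_laurent_poly g" shows "is_laurent_poly (f * g)"
proof -
  let ?A = "{k. f $$ k \<noteq> 0}" and ?B = "{k. g $$ k \<noteq> 0}"
  have "{k. (f * g) $$ k \<noteq> 0} \<subseteq> (\<lambda>(k, l). k + l) ` (?A \<times> ?B)"
  proof clarify
    fix i assume "(f * g) $$ i \<noteq> 0"
    then obtain l where "f $$ l \<noteq> 0" "g $$ (i - l) \<noteq> 0"
      by (rule fls_times_nth_nonzeroE)
    then show "i \<in> (\<lambda>(k, l). k + l) ` (?A \<times> ?B)"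
      by (intro image_eqI[of _ _ "(l, i - l)"]) auto
  qed
  then show ?thesis
    using assms unfolding is_laurent_poly_def by (meson finite_SigmaI finite_imageI finite_subset)
qed

lemma is_laurent_poly_fls_X: "is_laurent_poly fls_X"
  by (simp add: is_laurent_poly_def)

lemma is_laurent_poly_x_inf: "is_laurent_poly x_inf"
  by (simp add: is_laurent_poly_def)

lemma is_laurent_poly_of_nat: "is_laurent_poly (of_nat m)"
  by (simp add: is_laurent_poly_def fls_of_nat_nth)

lemma poly_at_inf_nth: "poly_at_inf q $$ i = (if i \<le> 0 then coeff q (nat (- i)) else 0)"
proof -
  have "poly_at_inf q = (\<Sum>k\<le>degree q. fls_const (coeff q k) * x_inf ^ k)"
    unfolding poly_at_inf_def poly_altdef
    by (subst degree_map_poly) (auto simp: coeff_map_poly)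
  then have "poly_at_inf q $$ i = (\<Sum>k\<le>degree q. if i = - int k then coeff q k else 0)"
    by (auto simp: fls_nth_sum intro!: sum.cong)
  also have "\<dots> = (\<Sum>k\<le>degree q. if k = nat (- i) \<and> i \<le> 0 then coeff q k else 0)"
    by (intro sum.cong) auto
  also have "\<dots> = (if i \<le> 0 then coeff q (nat (- i)) else 0)"
    by (cases "i \<le> 0") (auto simp: coeff_eq_0)
  finally show ?thesis .
qed

lemma is_laurent_poly_poly_at_inf: "is_laurent_poly (poly_at_inf q)"
proof -
  have "{k. poly_at_inf q $$ k \<noteq> 0} \<subseteq> {- int (degree q)..0}"
    by (auto simp: poly_at_inf_nth intro: le_degree split: if_splits)
       (metis le_degree le_nat_iff minus_le_iff nat_le_iff neg_0_le_iff_le)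
  then show ?thesis
    unfolding is_laurent_poly_def by (rule finite_subset) simp
qed

lemma poly_at_inf_smult: "poly_at_inf (smult c q) = fls_const c * poly_at_inf q"
  by (rule fls_eqI) (simp add: poly_at_inf_nth)

lemma ord_ge_poly_at_inf: "ord_ge 1 (- int (degree q)) (poly_at_inf q)"
  unfolding ord_ge_def poly_at_inf_nth
  using le_degree[of q] by (auto split: if_splits) (metis minus_le_iff nat_le_iff)

lemma poly_at_inf_eq_0_iff: "poly_at_inf q = 0 \<longleftrightarrow> q = 0"
proof
  assume "poly_at_inf q = 0"
  then have "poly_at_inf q $$ (- int k) = 0" for k
    by simp
  then show "q = 0"
    by (simp add: poly_at_inf_nth poly_eq_iff)
qed (simp add: poly_at_inf_def)

section \<open>Weights on truncated power series\<close>

text \<open>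
  The monomial \<open>x\<^sup>-\<^sup>i y\<^sup>j\<close> has weight \<open>a i + b j\<close>.  Only \<open>j < n\<close> is controlled: there \<open>W\<close> contracts, and
  the finitely many coefficients of any series have a common bound.
\<close>

definition weight_ge :: "nat \<Rightarrow> int \<Rightarrow> int \<Rightarrow> int \<Rightarrow> 'a::zero fls fps \<Rightarrow> bool" where
  "weight_ge n a b c h \<longleftrightarrow> (\<forall>j<n. ord_ge a (c - b * int j) (h $ j))"

lemma weight_ge_mult:
  fixes f g :: "'a::comm_ring_1 fls fps"
  assumes "weight_ge n a b c f" "weight_ge n a b d g"
  shows "weight_ge n a b (c + d) (f * g)"
  unfolding weight_ge_def fps_mult_nth
proof (intro allI impI ord_ge_sum)
  fix j k assume "j < n" "k \<in> {0..j}"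
  then have "ord_ge a ((c - b * int k) + (d - b * int (j - k))) (f $ k * g $ (j - k))"
    using assms by (intro ord_ge_mult) (auto simp: weight_ge_def simp del: of_nat_diff)
  moreover have "(c - b * int k) + (d - b * int (j - k)) = c + d - b * int j"
    using \<open>k \<in> {0..j}\<close> by (simp add: of_nat_diff algebra_simps)
  ultimately show "ord_ge a (c + d - b * int j) (f $ k * g $ (j - k))"
    by simp
qed

lemma weight_ge_exists:
  fixes h :: "'a::zero fls fps"
  assumes "0 \<le> a"
  shows "\<exists>c. weight_ge n a b c h"
proof -
  from ord_ge_exists[OF assms] have "\<forall>j. \<exists>d. ord_ge a d (h $ j)"
    by blast
  then obtain d where d: "\<And>j. ord_ge a (d j) (h $ j)"
    by metis
  let ?c = "Min ((\<lambda>j. d j + b * int j) ` {..<n})"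
  have "ord_ge a (?c - b * int j) (h $ j)" if "j < n" for j
  proof (rule ord_ge_mono[OF d])
    have "?c \<le> d j + b * int j"
      using that by (intro Min_le) auto
    then show "?c - b * int j \<le> d j" by simp
  qed
  then show ?thesis
    unfolding weight_ge_def by blast
qed

text \<open>
  Long division: a divisor with constant term \<open>x\<close> is invertible, and each step divides only by the monomial
  \<open>x\<close>.  Therefore quotients inherit weight bounds and stay within Laurent polynomials.
\<close>

lemma quotient_nth:
  assumes "q * g = f" "g $ 0 = x_inf"
  shows "q $ m = fls_X * (f $ m - (\<Sum>k<m. q $ k * g $ (m - k)))"
proof -
  have "f $ m = (\<Sum>k\<le>m. q $ k * g $ (m - k))"
    using assms(1) by (simp add: fps_mult_nth atMost_atLeast0 flip: assms(1))
  also have "\<dots> = (\<Sum>k<m. q $ k * g $ (m - k)) + q $ m * x_inf"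
    by (simp add: assms(2) flip: lessThan_Suc_atMost)
  finally have "f $ m - (\<Sum>k<m. q $ k * g $ (m - k)) = q $ m * x_inf"
    by simp
  moreover have "x_inf * fls_X = 1"
    by (metis fls_X_nonzero fls_inverse_X left_inverse)
  ultimately show ?thesis
    by (simp add: mult.commute mult.left_commute)
qed

lemma weight_ge_quotient:
  assumes "q * g = f" "g $ 0 = x_inf" "weight_ge n a b c f" "weight_ge n a b (- a) g"
  shows "weight_ge n a b (c + a) q"
proof -
  have "ord_ge a (c + a - b * int m) (q $ m)" if "m < n" for m
    using that
  proof (induction m rule: less_induct)
    case (less m)
    have "ord_ge a (c - b * int m) (q $ k * g $ (m - k))" if "k < m" for k
    proof -
      have "ord_ge a ((c + a - b * int k) + (- a - b * int (m - k))) (q $ k * g $ (m - k))"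
        using less that assms(4) by (intro ord_ge_mult) (auto simp: weight_ge_def simp del: of_nat_diff)
      moreover have "(c + a - b * int k) + (- a - b * int (m - k)) = c - b * int m"
        using that by (simp add: of_nat_diff algebra_simps)
      ultimately show ?thesis by simp
    qed
    then have "ord_ge a (c - b * int m) (f $ m - (\<Sum>k<m. q $ k * g $ (m - k)))"
      using assms(3) less.prems by (intro ord_ge_diff ord_ge_sum) (auto simp: weight_ge_def)
    then have "ord_ge a (a + (c - b * int m)) (q $ m)"
      unfolding quotient_nth[OF assms(1,2), of m] by (intro ord_ge_mult ord_ge_fls_X)
    then show ?case
      by (simp add: algebra_simps)
  qed
  then show ?thesis
    by (simp add: weight_ge_def)
qed

lemma is_laurent_poly_quotient:
  assumes "q * g = f" "g $ 0 = x_inf"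
    and "\<And>j. is_laurent_poly (f $ j)" "\<And>j. is_laurent_poly (g $ j)"
  shows "is_laurent_poly (q $ m)"
proof (induction m rule: less_induct)
  case (less m)
  then show ?case
    unfolding quotient_nth[OF assms(1,2), of m]
    by (intro is_laurent_poly_mult is_laurent_poly_diff is_laurent_poly_sum
        is_laurent_poly_fls_X assms) auto
qed

section \<open>The operator \<open>\<partial>\<^sub>y - n L\<close>\<close>

lemma Lop_nth: "Lop g $ j = g $ Suc j"
  by (simp add: Lop_def)

lemma deriv_minus_Lop_nth:
  "(fps_deriv g - of_nat n * Lop g) $ j = (of_nat (Suc j) - of_nat n) * g $ Suc j"
  by (simp only: fps_sub_nth fps_mult_of_nat_nth Lop_nth fps_deriv_nth left_diff_distrib Suc_eq_plus1)

text \<open>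
  Lowering the power of \<open>y\<close> by one costs \<open>b\<close>.  The index \<open>Suc j = n\<close> would need the uncontrolled
  coefficient of \<open>y\<^sup>n\<close>, but its factor \<open>n - n\<close> is zero.
\<close>

lemma weight_ge_deriv_minus_Lop:
  assumes "weight_ge n a b c h"
  shows "weight_ge n a b (c - b) (fps_deriv h - of_nat n * Lop h)"
  unfolding weight_ge_def deriv_minus_Lop_nth
proof (intro allI impI)
  fix j assume "j < n"
  show "ord_ge a (c - b - b * int j) ((of_nat (Suc j) - of_nat n) * h $ Suc j)"
  proof (cases "Suc j = n")
    case False
    then have "ord_ge a (c - b * int (Suc j)) (h $ Suc j)"
      using \<open>j < n\<close> assms by (simp add: weight_ge_def del: of_nat_Suc)
    then have "ord_ge a (0 + (c - b * int (Suc j))) ((of_nat (Suc j) - of_nat n) * h $ Suc j)"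
      by (intro ord_ge_mult ord_ge_diff ord_ge_of_nat)
    then show ?thesis
      by (simp add: algebra_simps)
  qed simp
qed

text \<open>
  After multiplication by \<open>y\<close> the left-hand side is \<open>(y \<partial>\<^sub>y - n) (Q h) + n Q h\<^sub>0\<close> with \<open>n = Suc m\<close>, and
  the operator \<open>y \<partial>\<^sub>y - n\<close> has no \<open>y\<^sup>n\<close> coefficient in its image.
\<close>

lemma Leibniz_deriv_minus_Lop_nth:
  "(fps_deriv Q * h + Q * (fps_deriv h - of_nat (Suc m) * Lop h)) $ m = of_nat (Suc m) * Q $ Suc m * h $ 0"
proof -
  have L: "(Q * (of_nat (Suc m) * Lop h)) $ m = of_nat (Suc m) * (Q * (h - fps_const (h $ 0))) $ Suc m"
  proof -
    have "h - fps_const (h $ 0) = fps_X * Lop h"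
      by (rule fps_ext) (simp add: Lop_nth)
    then have "(Q * (h - fps_const (h $ 0))) $ Suc m = (fps_X * (Q * Lop h)) $ Suc m"
      by (simp add: mult.left_commute)
    moreover have "(Q * (of_nat (Suc m) * Lop h)) $ m = of_nat (Suc m) * (Q * Lop h) $ m"
      by (simp only: mult.left_commute[of Q] fps_mult_of_nat_nth)
    ultimately show ?thesis by simp
  qed
  have "(fps_deriv Q * h + Q * (fps_deriv h - of_nat (Suc m) * Lop h)) $ m
      = fps_deriv (Q * h) $ m - (Q * (of_nat (Suc m) * Lop h)) $ m"
    by (simp add: algebra_simps)
  also have "\<dots> = of_nat (Suc m) * ((Q * h) $ Suc m - (Q * (h - fps_const (h $ 0))) $ Suc m)"
    unfolding L fps_deriv_nth by (simp add: algebra_simps)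
  also have "(Q * h) $ Suc m - (Q * (h - fps_const (h $ 0))) $ Suc m = Q $ Suc m * h $ 0"
    by (simp add: right_diff_distrib)
  finally show ?thesis
    by (simp add: mult.assoc)
qed

section \<open>Families of monic polynomials\<close>

locale monic_family =
  fixes p :: "nat \<Rightarrow> complex poly"
  assumes monic: "lead_coeff (p m) = 1"
    and degree_p: "degree (p m) = m"
    and p_1: "poly (p 1) 0 = 0"
begin

abbreviation "Q \<equiv> series_at_inf (Qser p)"
abbreviation "R \<equiv> Q / fps_deriv Q"

lemma coeff_top: "coeff (p m) m = 1"
  using monic[of m] degree_p[of m] by simp

lemma Q_nth: "Q $ m = fls_const (1 / fact m) * poly_at_inf (p m)"
  by (simp add: series_at_inf_def Qser_def poly_at_inf_smult)

lemma Q_nth_nonzero: "Q $ m \<noteq> 0"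
proof -
  have "p m \<noteq> 0"
    using coeff_top[of m] by auto
  then show ?thesis
    by (simp add: Q_nth poly_at_inf_eq_0_iff)
qed

lemma series_at_inf_deriv: "series_at_inf (fps_deriv (Qser p)) = fps_deriv Q"
proof (rule fps_ext)
  fix m
  have "fps_deriv (Qser p) $ m = smult (of_nat (Suc m)) (Qser p $ Suc m)"
    by (simp add: of_nat_poly)
  then show "series_at_inf (fps_deriv (Qser p)) $ m = fps_deriv Q $ m"
    by (simp add: series_at_inf_def poly_at_inf_smult fls_of_nat del: of_nat_Suc)
qed

lemma deriv_Q_nth: "fps_deriv Q $ m = fls_const (1 / fact m) * poly_at_inf (p (Suc m))"
proof -
  have "of_nat (Suc m) * fls_const (1 / fact (Suc m)) = (fls_const (1 / fact m) :: complex fls)"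
    by (simp add: fls_of_nat fls_const_mult_const del: of_nat_Suc)
  then show ?thesis
    by (simp add: Q_nth mult.assoc[symmetric] del: of_nat_Suc fact_Suc)
qed

lemma deriv_Q_0: "fps_deriv Q $ 0 = x_inf"
proof -
  have "coeff (p 1) 0 = 0"
    using p_1 by (simp add: poly_0_coeff_0)
  moreover have "coeff (p 1) k = 0" if "k > 1" for k
    using that degree_p[of 1] by (simp add: coeff_eq_0)
  ultimately have "poly_at_inf (p 1) $$ i = x_inf $$ i" for i
    using coeff_top[of 1] by (cases "nat (- i)" "1::nat" rule: linorder_cases) (auto simp: poly_at_inf_nth)
  then have "poly_at_inf (p (Suc 0)) = x_inf"
    by (simp add: fls_eqI)
  then show ?thesis
    unfolding deriv_Q_nth by simp
qed

lemma R_mult: "R * fps_deriv Q = Q"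
  using deriv_Q_0 by (simp add: fps_divide_unit mult.assoc inverse_mult_eq_1)

lemma weight_deriv_Q: "weight_ge n 1 1 (- 1) (fps_deriv Q)"
  unfolding weight_ge_def
proof (intro allI impI)
  fix j
  have "ord_ge 1 (- int (Suc j)) (poly_at_inf (p (Suc j)))"
    using ord_ge_poly_at_inf[of "p (Suc j)"] by (simp add: degree_p)
  then show "ord_ge 1 (- 1 - 1 * int j) (fps_deriv Q $ j)"
    unfolding deriv_Q_nth by (simp add: ord_ge_def)
qed

text \<open>
  The leading terms of \<open>p\<^sub>j\<close> and \<open>p\<^sub>j\<^sub>+\<^sub>1 / x\<close> cancel because both polynomials are monic, which
  gains one degree over the bound for each of the two series.
\<close>

lemma weight_numerator: "weight_ge n 1 1 1 (Q - fps_const fls_X * fps_deriv Q)"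
  unfolding weight_ge_def ord_ge_def
proof (intro allI impI)
  fix j i assume *: "(Q - fps_const fls_X * fps_deriv Q) $ j $$ i \<noteq> 0"
  show "1 - 1 * int j \<le> 1 * i"
  proof (rule ccontr)
    assume "\<not> ?thesis"
    then have i: "i \<le> 0" "j \<le> nat (- i)"  "nat (- (i - 1)) = Suc (nat (- i))"
      by auto
    have "(Q - fps_const fls_X * fps_deriv Q) $ j $$ i
        = 1 / fact j * (coeff (p j) (nat (- i)) - coeff (p (Suc j)) (nat (- (i - 1))))"
      using i(1) by (simp add: Q_nth deriv_Q_nth poly_at_inf_nth fls_X_times_conv_shift algebra_simps
         del: fps_deriv_nth)
    also have "coeff (p j) (nat (- i)) = coeff (p (Suc j)) (nat (- (i - 1)))"
      unfolding i(3) using i(2) coeff_top[of j] coeff_top[of "Suc j"]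
      by (cases "j = nat (- i)") (auto simp: coeff_eq_0 degree_p)
    finally show False
      using * by simp
  qed
qed

text \<open>
  Splitting off the leading part \<open>1/x\<close> leaves \<open>N / D\<close> with \<open>N = Q - D/x\<close>, all of whose monomials
  \<open>x\<^sup>-\<^sup>i y\<^sup>j\<close> satisfy \<open>i + j \<ge> 2\<close>.  For \<open>j < n\<close> this gives
  \<open>n i + (n - 1) j = n (i + j) - j \<ge> 2 n - j \<ge> n\<close>.
\<close>

lemma weight_R: "weight_ge n (int n) (int n - 1) (int n) R"
  unfolding weight_ge_def
proof (intro allI impI)
  fix j assume "j < n"
  have "(R - fps_const fls_X) * fps_deriv Q = Q - fps_const fls_X * fps_deriv Q"
    by (simp add: left_diff_distrib R_mult)
  from weight_ge_quotient[OF this deriv_Q_0 weight_numerator weight_deriv_Q]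
  have "ord_ge 1 (2 - int j) ((R - fps_const fls_X) $ j)"
    using \<open>j < n\<close> by (simp add: weight_ge_def)
  then have "ord_ge (int n) (int n * (2 - int j)) ((R - fps_const fls_X) $ j)"
    by (rule ord_ge_scale) simp
  then have 1: "ord_ge (int n) (int n - (int n - 1) * int j) ((R - fps_const fls_X) $ j)"
    by (rule ord_ge_mono) (use \<open>j < n\<close> in \<open>simp add: algebra_simps\<close>)
  have 2: "ord_ge (int n) (int n - (int n - 1) * int j) (fps_const fls_X $ j :: complex fls)"
    by (cases "j = 0") (auto intro: ord_ge_fls_X)
  from ord_ge_add[OF 1 2] show "ord_ge (int n) (int n - (int n - 1) * int j) (R $ j)"
    by (simp only: fps_sub_nth diff_add_cancel)
qed

lemma Wop_eq: "Wop p n h = R * (fps_deriv h - of_nat n * Lop h)"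
  by (simp add: Wop_def series_at_inf_deriv)

text \<open>
  The derivation part loses \<open>n - 1\<close> and multiplication by \<open>R\<close> gains \<open>n\<close>.
\<close>

lemma weight_Wop:
  assumes "weight_ge n (int n) (int n - 1) c h"
  shows "weight_ge n (int n) (int n - 1) (c + 1) (Wop p n h)"
proof -
  have "int n + (c - (int n - 1)) = c + 1"
    by simp
  then show ?thesis
    unfolding Wop_eq using weight_ge_mult[OF weight_R weight_ge_deriv_minus_Lop[OF assms]] by metis
qed

lemma weight_Wop_power:
  assumes "weight_ge n (int n) (int n - 1) c h"
  shows "weight_ge n (int n) (int n - 1) (c + int k) ((Wop p n ^^ k) h)"
proof (induction k)
  case (Suc k)
  from weight_Wop[OF this] show ?case by (simp add: algebra_simps)
qed (use assms in simp)

lemma is_laurent_poly_deriv_Q: "is_laurent_poly (fps_deriv Q $ j)"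
  unfolding deriv_Q_nth poly_at_inf_smult[symmetric] by (rule is_laurent_poly_poly_at_inf)

lemma is_laurent_poly_R: "is_laurent_poly (R $ j)"
proof (rule is_laurent_poly_quotient[OF R_mult deriv_Q_0 _ is_laurent_poly_deriv_Q])
  show "is_laurent_poly (Q $ j)" for j
    by (simp add: series_at_inf_def is_laurent_poly_poly_at_inf)
qed

lemma is_laurent_poly_Wop:
  assumes "\<And>j. is_laurent_poly (h $ j)"
  shows "is_laurent_poly (Wop p n h $ j)"
  unfolding Wop_eq fps_mult_nth deriv_minus_Lop_nth
  by (intro is_laurent_poly_sum is_laurent_poly_mult is_laurent_poly_diff is_laurent_poly_R
      is_laurent_poly_of_nat assms)

lemma Fser_mult:
  "Fser p * fps_deriv Q = fps_const x_inf * fps_shift 1 (series_at_inf (dx (Qser p)))"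
proof -
  have "fps_const x_inf * series_at_inf (dx (Qser p)) / fps_X
      = fps_const x_inf * fps_shift 1 (series_at_inf (dx (Qser p)))"
    by (rule fps_ext) simp
  then show ?thesis
    using deriv_Q_0 by (simp add: Fser_def series_at_inf_deriv fps_divide_unit mult.assoc inverse_mult_eq_1)
qed

lemma is_laurent_poly_Wop_power_Fser: "is_laurent_poly ((Wop p n ^^ k) (Fser p) $ j)"
proof (induction k arbitrary: j)
  case 0
  have "is_laurent_poly (Fser p $ j)"
    by (rule is_laurent_poly_quotient[OF Fser_mult deriv_Q_0 _ is_laurent_poly_deriv_Q])
       (auto simp: series_at_inf_def intro!: is_laurent_poly_mult is_laurent_poly_x_inf is_laurent_poly_poly_at_inf)
  then show ?case by simp
next
  case (Suc k)
  then show ?case by (simp add: is_laurent_poly_Wop)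
qed

lemma Fser_mult_nth:
  "(fps_deriv Q * Fser p) $ m = x_inf * (fls_const (1 / fact (Suc m)) * poly_at_inf (pderiv (p (Suc m))))"
  unfolding mult.commute[of "fps_deriv Q"] Fser_mult
  by (simp add: series_at_inf_def dx_def Qser_def pderiv_smult poly_at_inf_smult del: fact_Suc)

lemma Wop_telescope:
  "of_nat (Suc m) * Q $ Suc m * h $ 0
    = (fps_deriv Q * h) $ m + (fps_deriv Q * Wop p (Suc m) h) $ m"
proof -
  have "fps_deriv Q * Wop p (Suc m) h = (R * fps_deriv Q) * (fps_deriv h - of_nat (Suc m) * Lop h)"
    by (simp add: Wop_eq mult_ac)
  then show ?thesis
    using Leibniz_deriv_minus_Lop_nth[of Q h m] by (simp add: R_mult)
qed

text \<open>
  The alternating sums telescope, and their remainder tends to zero for an arbitrary \<open>h\<close>.  Some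
  weight bound holds for \<open>h\<close> by \<open>weight_ge_exists\<close>, and every application of \<open>W\<close> improves it by one.
\<close>

lemma Wop_sums:
  "(\<lambda>k. (- 1) ^ k * (Wop p (Suc m) ^^ k) h $ 0) sums
    ((fps_deriv Q * h) $ m / (of_nat (Suc m) * Q $ Suc m))"
proof -
  define n where "n = Suc m"
  define u where "u = inverse (of_nat n * Q $ n)"
  define V where "V = fps_const u * fps_deriv Q"
  \<comment> \<open>Moving the factor \<open>u\<close> inside the series \<open>V\<close> lets \<open>weight_ge_mult\<close> bound \<open>b k\<close> as a coefficient.\<close>
  define b where "b k = (V * (Wop p n ^^ k) h) $ m" for k
  have b_alt: "b k = u * (fps_deriv Q * (Wop p n ^^ k) h) $ m" for k
    unfolding b_def V_def mult.assoc by simp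
  have nz: "of_nat n * Q $ n \<noteq> 0"
    using Q_nth_nonzero by (simp add: n_def del: of_nat_Suc)
  have a_eq: "(Wop p n ^^ k) h $ 0 = b k + b (Suc k)" for k
  proof -
    have "b k + b (Suc k) = u * (of_nat n * Q $ n * (Wop p n ^^ k) h $ 0)"
      using Wop_telescope[of m "(Wop p n ^^ k) h"] by (simp add: b_alt n_def distrib_left)
    moreover have "u * (of_nat n * Q $ n) = 1"
      unfolding u_def using nz by (rule left_inverse)
    ultimately show ?thesis
      by (simp only: mult.assoc[of u, symmetric] mult_1_left)
  qed
  have partial: "(\<Sum>k<K. (- 1) ^ k * (Wop p n ^^ k) h $ 0) = b 0 - (- 1) ^ K * b K" for K
    by (induction K) (auto simp: a_eq algebra_simps)
  obtain c where c: "weight_ge n (int n) (int n - 1) c h"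
    using weight_ge_exists[of "int n" n "int n - 1" h] by auto
  obtain d where d: "weight_ge n (int n) (int n - 1) d V"
    using weight_ge_exists[of "int n" n "int n - 1" V] by auto
  have b_ord: "ord_ge (int n) (d + (c + int k) - int m * int m) (b k)" for k
    using weight_ge_mult[OF d weight_Wop_power[OF c, of k]]
    unfolding b_def weight_ge_def n_def by auto
  have "(\<lambda>K. \<Sum>k<K. (- 1) ^ k * (Wop p n ^^ k) h $ 0) \<longlonglongrightarrow> b 0"
  proof (rule fls_tendstoI)
    fix N
    show "\<forall>\<^sub>F K in sequentially. ord_ge 1 N ((\<Sum>k<K. (- 1) ^ k * (Wop p n ^^ k) h $ 0) - b 0)"
    proof (rule eventually_sequentiallyI)
      fix K assume K: "nat (int n * N - d - c + int m * int m) \<le> K"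
      have "ord_ge 1 N (b K)"
        unfolding ord_ge_def
      proof (intro allI impI)
        fix i assume "b K $$ i \<noteq> 0"
        then have "int n * N \<le> int n * i"
          using ord_geD[OF b_ord[of K], of i] K by linarith
        then show "N \<le> 1 * i"
          by (simp add: n_def del: of_nat_Suc)
      qed
      then have "ord_ge 1 N (- ((- 1) ^ K * b K))"
        by (cases "even K") (auto simp: ord_ge_def)
      then show "ord_ge 1 N ((\<Sum>k<K. (- 1) ^ k * (Wop p n ^^ k) h $ 0) - b 0)"
        by (simp add: partial)
    qed
  qed
  moreover have "b 0 = (fps_deriv Q * h) $ m / (of_nat n * Q $ n)"
    by (simp add: b_alt u_def field_simps)
  ultimately show ?thesis
    unfolding sums_def n_def by simp
qed

end

theorem mainTheorem1:
  fixes p :: "nat \<Rightarrow> complex poly" and n :: nat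
  assumes "\<And>m. lead_coeff (p m) = 1"
    and "\<And>m. degree (p m) = m"
    and "\<And>m. m \<ge> 1 \<Longrightarrow> poly (p m) 0 = 0"
    and "n \<ge> 1"
  shows "(\<forall>k. is_laurent_poly (fps_nth ((Wop p n ^^ k) (Fser p)) 0)) \<and>
    (\<lambda>k. (- 1) ^ k * fps_nth ((Wop p n ^^ k) (Fser p)) 0) sums
      (x_inf / of_nat n * (poly_at_inf (pderiv (p n)) / poly_at_inf (p n)))"
proof -
  interpret monic_family p
    by standard (use assms in auto)
  obtain m where n: "n = Suc m"
    using assms(4) by (cases n) auto
  have P: "poly_at_inf (p n) \<noteq> 0"
    using Q_nth_nonzero[of n] by (auto simp: Q_nth)
  have "(fps_deriv Q * Fser p) $ m / (of_nat n * Q $ n)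
      = x_inf / of_nat n * (poly_at_inf (pderiv (p n)) / poly_at_inf (p n))"
    unfolding Fser_mult_nth Q_nth using P by (simp add: n field_simps del: of_nat_Suc fact_Suc)
  then show ?thesis
    using Wop_sums[of m "Fser p"] is_laurent_poly_Wop_power_Fser by (simp add: n)
qed

end
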